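(* Let $P_0$ and $P_0'$ be two distributions of random graphs on vertex set $[n]$, let $e_1,\dots,e_K\in\binom{[n]}{2}$, and let $p_1,\dots,p_K\in[0,1]$. For $0\le i\le K$ let $P_{1,i}$ be the law obtained by starting with $P_0$ and resampling edges $e_1,\dots,e_i$ with probabilities $p_1,\dots,p_i$ respectively. Let $\epsilon,\delta\ge 0$, and let $\mathcal G$ be a set of graphs on $n$ vertices such that $\Pr_{G\sim P_{1,i}}(G\in\mathcal G)\ge 1-\delta$ for every $0\le i\le K$. Let $\mathcal A$ be a randomized mapping between graphs on $n$ vertices satisfying $\mathcal A(P_0)=P_0'$. Suppose that for each $e\in\binom{[n]}{2}$ there exist $p_-^e,p_+^e\in[0,1]$ such that for every $G\in\mathcal G$: (C1) $d_{TV}\big(\mathcal A(G-e)|_{\sim e},\ \mathcal A(G+e)|_{\sim e}\big)\le\epsilon$; (C2) $d_{TV}\big(\mathcal A(G-e),\ \mathcal A(G-e)|_{\sim e}\times\mathcal A(G-e)|_e\big)\le\epsilon$ and $d_{TV}\big(\mathcal A(G+e),\ \mathcal A(G+e)|_{\sim e}\times\mathcal A(G+e)|_e\big)\le\epsilon$; (C3) $|\Pr(e\in\mathcal A(G-e))-p_-^e|\le\epsilon$ and $|\Pr(e\in\mathcal A(G+e))-p_+^e|\le\epsilon$. Then $$d_{TV}\big(\mathcal A(\mathrm{GPS}_{\vec e,\vec p}(P_0)),\ \mathrm{GPS}_{\vec e,\vec q}(P_0')\big)=O(K(\epsilon+\delta)),$$ where $q_i=p_ip_+^{e_i}+(1-p_i)p_-^{e_i}$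 for each $i\in[K]$ and the implied constant is absolute.
   Context: Graphs on $[n]$ are identified with subsets of $\binom{[n]}{2}$ (equivalently, with indicator vectors). For a graph $G$ and $e\in\binom{[n]}2$, $G+e$ and $G-e$ are $G$ with edge $e$ added, respectively removed. For a random graph $H$, $H|_{\sim e}$ is (the law of) its restriction to $\binom{[n]}{2}\setminus\{e\}$ and $H|_e$ is (the law of) the indicator of $e\in H$; $\times$ denotes product of laws. Resampling edge $e$ with probability $p$ means replacing the status of $e$ by an independent $\mathrm{Bernoulli}(p)$ indicator of presence. $\mathrm{GPS}_{\vec e,\vec p}(P)$, for $\vec e=(e_1,\dots,e_K)$, $\vec p=(p_1,\dots,p_K)$, is the law obtained by sampling a graph from $P$ and, for each $i=1,\dots,K$, resampling $e_i$ with probability $p_i$. For a randomized mapping (Markov kernel) $\mathcal A$ and a distribution $\mu$, $\mathcal A(\mu)$ is the law of $\mathcal A(X)$, $X\sim\mu$. $d_{TV}$ is total variation distance. *)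

theory Defs
  imports "HOL-Probability.Probability"
begin

type_synonym edge = "nat set"
type_synonym graph = "edge set"

text \<open>A graph on \<open>[n] = {1,\<dots>,n}\<close> is its set of edges. The edge type is not bounded by \<open>n\<close>,
  so laws of random graphs are PMFs that are required to be supported on \<open>graphs n\<close>.\<close>

definition edges :: "nat \<Rightarrow> edge set" where
  "edges n = {e. e \<subseteq> {1..n} \<and> card e = 2}"

definition graphs :: "nat \<Rightarrow> graph set" where
  "graphs n = Pow (edges n)"

definition random_graph :: "nat \<Rightarrow> graph pmf \<Rightarrow> bool" where
  "random_graph n P \<longleftrightarrow> set_pmf P \<subseteq> graphs n"

text \<open>Randomized mappings between graphs on \<open>[n]\<close>; the law \<open>\<A>(\<mu>)\<close> is \<open>bind_pmf \<mu> \<A>\<close>.\<close>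

definition random_graph_map :: "nat \<Rightarrow> (graph \<Rightarrow> graph pmf) \<Rightarrow> bool" where
  "random_graph_map n \<A> \<longleftrightarrow> (\<forall>G\<in>graphs n. random_graph n (\<A> G))"

definition add_edge :: "graph \<Rightarrow> edge \<Rightarrow> graph" where
  "add_edge G e = G \<union> {e}"

definition del_edge :: "graph \<Rightarrow> edge \<Rightarrow> graph" where
  "del_edge G e = G - {e}"

definition set_edge :: "edge \<Rightarrow> graph \<Rightarrow> bool \<Rightarrow> graph" where
  "set_edge e G b = (if b then add_edge G e else del_edge G e)"

definition d_TV :: "'a pmf \<Rightarrow> 'a pmf \<Rightarrow> real" where
  "d_TV P Q = (SUP S. \<bar>measure_pmf.prob P S - measure_pmf.prob Q S\<bar>)"

text \<open>The restriction of a graph to the potential edges other than \<open>e\<close> is again a set of edges.\<close>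

definition restrict_away :: "edge \<Rightarrow> graph pmf \<Rightarrow> graph pmf" where
  "restrict_away e P = map_pmf (\<lambda>G. G - {e}) P"

definition restrict_to :: "edge \<Rightarrow> graph pmf \<Rightarrow> bool pmf" where
  "restrict_to e P = map_pmf (\<lambda>G. e \<in> G) P"

text \<open>A product law lives on pairs \<open>(H, b)\<close> of a graph avoiding \<open>e\<close> and an indicator for \<open>e\<close>;
  such pairs are identified with graphs via \<open>set_edge e\<close>.\<close>

definition edge_product :: "edge \<Rightarrow> graph pmf \<Rightarrow> bool pmf \<Rightarrow> graph pmf" where
  "edge_product e Q R = map_pmf (\<lambda>(H, b). set_edge e H b) (pair_pmf Q R)"

definition resample :: "edge \<Rightarrow> real \<Rightarrow> graph pmf \<Rightarrow> graph pmf" where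
  "resample e p P = map_pmf (\<lambda>(G, b). set_edge e G b) (pair_pmf P (bernoulli_pmf p))"

text \<open>\<open>GPS es ps K P\<close> uses only the entries \<open>1,\<dots>,K\<close> of \<open>es\<close> and \<open>ps\<close>. The edges may repeat;
  they are resampled in order.\<close>

primrec GPS :: "(nat \<Rightarrow> edge) \<Rightarrow> (nat \<Rightarrow> real) \<Rightarrow> nat \<Rightarrow> graph pmf \<Rightarrow> graph pmf" where
  "GPS es ps 0 P = P"
| "GPS es ps (Suc i) P = resample (es (Suc i)) (ps (Suc i)) (GPS es ps i P)"

end

theory Submission
  imports Defs
begin

text \<open>
  Single step: for \<open>G\<close> in the good set and \<open>b\<close> a value for the edge \<open>e\<close>, conditions (C2), (C1), (C3)
  successively replace \<open>\<A>(G \<plusminus> e)\<close> by the product of its marginals, its first marginal by that of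
  \<open>\<A>(G)\<close> (which is one of \<open>\<A>(G \<plusminus> e)\<close>), and its second marginal by the Bernoulli law of parameter
  \<open>p\<^sub>\<plusminus>\<close>, at total cost \<open>3\<epsilon>\<close>. Averaging over \<open>b\<close> turns the result into \<open>\<A>(G)\<close> with \<open>e\<close> resampled
  with probability \<open>q\<close>. Averaging over \<open>G\<close> costs a further \<open>\<delta>\<close> for the bad graphs. Since resampling
  contracts total variation, the errors of the \<open>K\<close> steps add up to at most \<open>K(3\<epsilon> + \<delta>)\<close>.
\<close>

section \<open>Total variation distance and mixtures\<close>

lemma abs_prob_diff_le_1:
  "\<bar>measure_pmf.prob P S - measure_pmf.prob Q S\<bar> \<le> 1"
  using measure_pmf.prob_le_1[of P S] measure_pmf.prob_le_1[of Q S]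
    measure_nonneg[of "measure_pmf P" S] measure_nonneg[of "measure_pmf Q" S]
  by linarith

lemma d_TV_leI:
  assumes "\<And>S. \<bar>measure_pmf.prob P S - measure_pmf.prob Q S\<bar> \<le> c"
  shows "d_TV P Q \<le> c"
  unfolding d_TV_def using assms by (intro cSUP_least) auto

lemma abs_prob_diff_le_d_TV:
  "\<bar>measure_pmf.prob P S - measure_pmf.prob Q S\<bar> \<le> d_TV P Q"
  unfolding d_TV_def
  by (rule cSUP_upper) (auto intro!: bdd_aboveI[where M = 1] abs_prob_diff_le_1)

lemma d_TV_refl [simp]: "d_TV P P = 0"
  by (simp add: d_TV_def)

lemma d_TV_nonneg: "0 \<le> d_TV P Q"
  using abs_prob_diff_le_d_TV[of P "{}" Q] by simp

lemma d_TV_commute: "d_TV P Q = d_TV Q P"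
  by (simp add: d_TV_def abs_minus_commute)

lemma d_TV_triangle: "d_TV P R \<le> d_TV P Q + d_TV Q R"
proof (rule d_TV_leI)
  fix S
  show "\<bar>measure_pmf.prob P S - measure_pmf.prob R S\<bar> \<le> d_TV P Q + d_TV Q R"
    using abs_prob_diff_le_d_TV[of P S Q] abs_prob_diff_le_d_TV[of Q S R] by linarith
qed

lemma d_TV_map_le: "d_TV (map_pmf f P) (map_pmf f Q) \<le> d_TV P Q"
  by (rule d_TV_leI) (simp add: abs_prob_diff_le_d_TV)

lemma prob_bind_pmf:
  "measure_pmf.prob (bind_pmf P f) S = (\<integral>x. measure_pmf.prob (f x) S \<partial>measure_pmf P)"
  unfolding measure_pmf_bind
  by (subst measure_pmf.measure_bind[where N = "count_space UNIV"])
     (auto simp: measure_pmf_in_subprob_algebra)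

text \<open>Condition on \<open>x\<close>: the two probabilities of an event differ by at most
  \<open>c\<close> for \<open>x\<close> in \<open>A\<close> and by at most 1 otherwise, and the
  latter case has mass at most \<delta>. The bound \<open>0 \<le> c\<close> keeps the common
  majorant \<open>c + indicator (- A) x\<close> valid outside \<open>A\<close>.\<close>

lemma d_TV_bind_le_exceptional:
  assumes c: "0 \<le> c" and fg: "\<And>x. x \<in> A \<Longrightarrow> d_TV (f x) (g x) \<le> c"
    and A: "measure_pmf.prob P A \<ge> 1 - \<delta>"
  shows "d_TV (bind_pmf P f) (bind_pmf P g) \<le> c + \<delta>"
proof (rule d_TV_leI)
  fix S
  have int: "integrable (measure_pmf P) (\<lambda>x. measure_pmf.prob (h x) S)" for h :: "'a \<Rightarrow> 'b pmf"
    by (rule measure_pmf.integrable_const_bound[where B = 1]) auto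
  have ind: "integrable (measure_pmf P) (indicator (- A) :: 'a \<Rightarrow> real)"
    by (rule measure_pmf.integrable_const_bound[where B = 1]) auto
  let ?D = "\<lambda>x. measure_pmf.prob (f x) S - measure_pmf.prob (g x) S"
  have "\<bar>measure_pmf.prob (bind_pmf P f) S - measure_pmf.prob (bind_pmf P g) S\<bar>
      = \<bar>\<integral>x. ?D x \<partial>measure_pmf P\<bar>"
    by (simp add: prob_bind_pmf int)
  also have "\<dots> \<le> (\<integral>x. \<bar>?D x\<bar> \<partial>measure_pmf P)"
    by (rule integral_abs_bound)
  also have "\<dots> \<le> (\<integral>x. c + indicator (- A) x \<partial>measure_pmf P)"
  proof (rule integral_mono)
    fix x
    show "\<bar>?D x\<bar> \<le> c + indicator (- A) x"
    proof (cases "x \<in> A")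
      case True
      then show ?thesis
        using fg[of x] abs_prob_diff_le_d_TV[of "f x" S "g x"] by simp
    next
      case False
      then show ?thesis
        using c abs_prob_diff_le_1[of "f x" S "g x"] by simp
    qed
  qed (auto intro!: integrable_abs Bochner_Integration.integrable_diff int Bochner_Integration.integrable_add ind)
  also have "\<dots> = c + measure_pmf.prob P (- A)"
    by (simp add: ind)
  also have "\<dots> \<le> c + \<delta>"
    using A measure_pmf.prob_compl[of A P] by (simp add: Compl_eq_Diff_UNIV)
  finally show "\<bar>measure_pmf.prob (bind_pmf P f) S - measure_pmf.prob (bind_pmf P g) S\<bar> \<le> c + \<delta>" .
qed

lemma d_TV_bind_le:
  assumes "\<And>x. d_TV (f x) (g x) \<le> c"
  shows "d_TV (bind_pmf P f) (bind_pmf P g) \<le> c"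
proof -
  have "0 \<le> c"
    using d_TV_nonneg assms by (rule order_trans)
  then show ?thesis
    using d_TV_bind_le_exceptional[where c = c and A = UNIV and f = f and g = g and P = P and \<delta> = 0] assms by simp
qed

text \<open>There are only four events: the two trivial ones contribute 0, and the two singletons
  give the same discrepancy because the masses sum to 1.\<close>

lemma d_TV_bool_le: "d_TV P Q \<le> \<bar>pmf P True - pmf Q True\<bar>"
proof (rule d_TV_leI)
  fix S :: "bool set"
  have sum1: "pmf R False = 1 - pmf R True" for R :: "bool pmf"
    using measure_pmf.prob_space[of R]
    by (simp add: UNIV_bool measure_measure_pmf_finite)
  have "S \<in> Pow UNIV" by simp
  then consider "S = {}" | "S = {True}" | "S = {False}" | "S = {True, False}"
    unfolding UNIV_bool by (auto simp: Pow_insert)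
  then show "\<bar>measure_pmf.prob P S - measure_pmf.prob Q S\<bar> \<le> \<bar>pmf P True - pmf Q True\<bar>"
    by cases (simp_all add: measure_measure_pmf_finite sum1)
qed

text \<open>This is the source of the formula for the new probabilities \<open>q\<close>: a coin of
  bias \<open>p\<close> selects which of two biased coins is tossed.\<close>

lemma bernoulli_mixture:
  assumes "p \<in> {0..1}" "a \<in> {0..1}" "b \<in> {0..1}"
  shows "bind_pmf (bernoulli_pmf p) (\<lambda>c. bernoulli_pmf (if c then a else b))
    = bernoulli_pmf (p * a + (1 - p) * b)"
proof -
  \<comment> \<open>The usual values of \<open>pmf (bernoulli_pmf _)\<close> hold for parameters in
    the unit interval, so convexity is checked first.\<close>
  have "p * a + (1 - p) * b \<in> {0..1}"
    using assms convex_bound_le[of a 1 b p "1 - p"] by simp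
  then have "pmf (bind_pmf (bernoulli_pmf p) (\<lambda>c. bernoulli_pmf (if c then a else b))) i
      = pmf (bernoulli_pmf (p * a + (1 - p) * b)) i" for i
    using assms by (cases i) (auto simp: pmf_bind algebra_simps)
  then show ?thesis
    by (rule pmf_eqI)
qed

section \<open>Product laws and resampling\<close>

lemma edge_product_bind_left:
  "edge_product e Q R = bind_pmf Q (\<lambda>H. map_pmf (set_edge e H) R)"
  by (simp add: edge_product_def pair_pmf_def map_pmf_def bind_assoc_pmf bind_return_pmf)

lemma edge_product_bind_right:
  "edge_product e Q R = bind_pmf R (\<lambda>b. map_pmf (\<lambda>H. set_edge e H b) Q)"
  unfolding edge_product_bind_left map_pmf_def by (rule bind_commute_pmf)

text \<open>Draw the common factor first: given its value \<open>b\<close>, the two laws are images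
  of \<open>Q\<close> and \<open>Q'\<close> under one map, and neither mapping nor mixing increases
  the distance.\<close>

lemma d_TV_edge_product_left: "d_TV (edge_product e Q R) (edge_product e Q' R) \<le> d_TV Q Q'"
  unfolding edge_product_bind_right by (intro d_TV_bind_le d_TV_map_le)

lemma d_TV_edge_product_right: "d_TV (edge_product e Q R) (edge_product e Q R') \<le> d_TV R R'"
  unfolding edge_product_bind_left by (intro d_TV_bind_le d_TV_map_le)

lemma edge_product_bind_pmf:
  "edge_product e Q (bind_pmf R f) = bind_pmf R (\<lambda>b. edge_product e Q (f b))"
  by (simp add: edge_product_bind_right bind_assoc_pmf)

lemma resample_bind_left:
  "resample e p P = bind_pmf P (\<lambda>G. map_pmf (set_edge e G) (bernoulli_pmf p))"
  by (simp add: resample_def pair_pmf_def map_pmf_def bind_assoc_pmf bind_return_pmf)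

text \<open>\<open>set_edge e\<close> overwrites the old status of \<open>e\<close>, so resampling
  sees \<open>P\<close> only through its restriction away from \<open>e\<close>. This gives
  resampling the product form that also occurs in (C2).\<close>

lemma resample_eq_edge_product:
  "resample e p P = edge_product e (restrict_away e P) (bernoulli_pmf p)"
proof -
  have "set_edge e (G - {e}) = set_edge e G" for G
    by (auto simp: fun_eq_iff set_edge_def add_edge_def del_edge_def)
  then show ?thesis
    by (simp add: resample_bind_left edge_product_bind_left restrict_away_def bind_map_pmf)
qed

lemma resample_bind_pmf: "resample e p (bind_pmf P f) = bind_pmf P (\<lambda>x. resample e p (f x))"
  by (simp add: resample_bind_left bind_assoc_pmf)

text \<open>Exposes \<open>P\<close> as the outer mixing law, so that the two orders of resampling
  and applying \<open>\<A>\<close> can be compared graph by graph.\<close>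

lemma bind_resample:
  "bind_pmf (resample e p P) \<A>
    = bind_pmf P (\<lambda>G. bind_pmf (bernoulli_pmf p) (\<lambda>b. \<A> (set_edge e G b)))"
  by (simp add: resample_bind_left bind_assoc_pmf bind_map_pmf)

lemma d_TV_resample_le: "d_TV (resample e p P) (resample e p Q) \<le> d_TV P Q"
  unfolding resample_eq_edge_product restrict_away_def
  using d_TV_edge_product_left d_TV_map_le by (rule order_trans)

section \<open>Error of one resampling step\<close>

lemma d_TV_single_graph:
  fixes G :: graph and a :: "bool \<Rightarrow> real"
  assumes p: "p \<in> {0..1}" and a: "\<And>b. a b \<in> {0..1}" and \<epsilon>: "0 \<le> \<epsilon>"
    and C1: "d_TV (restrict_away e (\<A> (set_edge e G False)))
        (restrict_away e (\<A> (set_edge e G True))) \<le> \<epsilon>"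
    and C2: "\<And>b. d_TV (\<A> (set_edge e G b))
        (edge_product e (restrict_away e (\<A> (set_edge e G b)))
          (restrict_to e (\<A> (set_edge e G b)))) \<le> \<epsilon>"
    and C3: "\<And>b. \<bar>measure_pmf.prob (\<A> (set_edge e G b)) {H. e \<in> H} - a b\<bar> \<le> \<epsilon>"
  shows "d_TV (bind_pmf (bernoulli_pmf p) (\<lambda>b. \<A> (set_edge e G b)))
      (resample e (p * a True + (1 - p) * a False) (\<A> G)) \<le> 3 * \<epsilon>"
proof -
  let ?Q = "\<lambda>b. restrict_away e (\<A> (set_edge e G b))"
  let ?R = "\<lambda>b. restrict_to e (\<A> (set_edge e G b))"
  \<comment> \<open>Setting \<open>e\<close> to its present status changes nothing; this later
    identifies \<open>?Q (e \<in> G)\<close> with the restriction of \<open>\<A> G\<close>.\<close>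
  have G: "set_edge e G (e \<in> G) = G"
    by (auto simp: set_edge_def add_edge_def del_edge_def)
  have Q: "d_TV (?Q b) (?Q b') \<le> \<epsilon>" for b b'
    using C1 \<epsilon> by (cases b; cases b') (simp_all add: d_TV_commute)
  have R: "d_TV (?R b) (bernoulli_pmf (a b)) \<le> \<epsilon>" for b
  proof -
    have "pmf (?R b) True = measure_pmf.prob (\<A> (set_edge e G b)) {H. e \<in> H}"
      by (simp add: restrict_to_def pmf_map vimage_def)
    then show ?thesis
      using d_TV_bool_le[of "?R b" "bernoulli_pmf (a b)"] C3[of b] a[of b] by simp
  qed
  \<comment> \<open>The first factor of the target does not depend on \<open>b\<close>. Hence the
    mixture over \<open>b\<close> acts on the Bernoulli factor alone and collapses to a single
    product.\<close>
  have step: "d_TV (\<A> (set_edge e G b))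
      (edge_product e (restrict_away e (\<A> G)) (bernoulli_pmf (a b))) \<le> 3 * \<epsilon>" for b
  proof -
    let ?X = "edge_product e (?Q b) (?R b)"
    let ?Y = "edge_product e (restrict_away e (\<A> G)) (?R b)"
    let ?Z = "edge_product e (restrict_away e (\<A> G)) (bernoulli_pmf (a b))"
    have XY: "d_TV ?X ?Y \<le> \<epsilon>"
      using d_TV_edge_product_left Q[of b "e \<in> G", unfolded G] by (rule order_trans)
    have YZ: "d_TV ?Y ?Z \<le> \<epsilon>"
      using d_TV_edge_product_right R by (rule order_trans)
    show ?thesis
      using C2[of b] XY YZ d_TV_triangle[of "\<A> (set_edge e G b)" ?Z ?X] d_TV_triangle[of ?X ?Z ?Y]
      by linarith
  qed
  have "resample e (p * a True + (1 - p) * a False) (\<A> G)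
      = bind_pmf (bernoulli_pmf p)
          (\<lambda>b. edge_product e (restrict_away e (\<A> G)) (bernoulli_pmf (if b then a True else a False)))"
    unfolding resample_eq_edge_product
    using bernoulli_mixture[OF p a a, of True False] by (simp flip: edge_product_bind_pmf)
  also have "(\<lambda>b. bernoulli_pmf (if b then a True else a False)) = (\<lambda>b. bernoulli_pmf (a b))"
    by (auto simp: fun_eq_iff)
  finally show ?thesis
    using step by (auto intro: d_TV_bind_le)
qed

lemma d_TV_resample_step:
  fixes a :: "bool \<Rightarrow> real"
  assumes "p \<in> {0..1}" "\<And>b. a b \<in> {0..1}" "0 \<le> \<epsilon>"
    and good: "measure_pmf.prob P \<G> \<ge> 1 - \<delta>"
    and C1: "\<And>G. G \<in> \<G> \<Longrightarrow> d_TV (restrict_away e (\<A> (set_edge e G False)))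
        (restrict_away e (\<A> (set_edge e G True))) \<le> \<epsilon>"
    and C2: "\<And>G b. G \<in> \<G> \<Longrightarrow> d_TV (\<A> (set_edge e G b))
        (edge_product e (restrict_away e (\<A> (set_edge e G b)))
          (restrict_to e (\<A> (set_edge e G b)))) \<le> \<epsilon>"
    and C3: "\<And>G b. G \<in> \<G> \<Longrightarrow>
        \<bar>measure_pmf.prob (\<A> (set_edge e G b)) {H. e \<in> H} - a b\<bar> \<le> \<epsilon>"
  shows "d_TV (bind_pmf (resample e p P) \<A>)
      (resample e (p * a True + (1 - p) * a False) (bind_pmf P \<A>)) \<le> 3 * \<epsilon> + \<delta>"
  unfolding bind_resample resample_bind_pmf
  using assms by (intro d_TV_bind_le_exceptional[where A = \<G>] d_TV_single_graph) auto

theorem theorem2p1: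
  "\<exists>C::real. C > 0 \<and>
    (\<forall>(n::nat) (K::nat) (P0::graph pmf) (P0'::graph pmf) (es::nat \<Rightarrow> edge) (ps::nat \<Rightarrow> real)
      (\<epsilon>::real) (\<delta>::real) (\<G>::graph set) (\<A>::graph \<Rightarrow> graph pmf)
      (pminus::edge \<Rightarrow> real) (pplus::edge \<Rightarrow> real).
      random_graph n P0 \<longrightarrow>
      random_graph n P0' \<longrightarrow>
      (\<forall>i\<in>{1..K}. es i \<in> edges n) \<longrightarrow>
      (\<forall>i\<in>{1..K}. ps i \<in> {0..1}) \<longrightarrow>
      \<epsilon> \<ge> 0 \<longrightarrow>
      \<delta> \<ge> 0 \<longrightarrow>
      \<G> \<subseteq> graphs n \<longrightarrow>
      (\<forall>i\<le>K. measure_pmf.prob (GPS es ps i P0) \<G> \<ge> 1 - \<delta>) \<longrightarrow>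
      random_graph_map n \<A> \<longrightarrow>
      bind_pmf P0 \<A> = P0' \<longrightarrow>
      (\<forall>e\<in>edges n. pminus e \<in> {0..1} \<and> pplus e \<in> {0..1} \<and>
        (\<forall>G\<in>\<G>.
          d_TV (restrict_away e (\<A> (del_edge G e))) (restrict_away e (\<A> (add_edge G e))) \<le> \<epsilon> \<and>
          d_TV (\<A> (del_edge G e))
            (edge_product e (restrict_away e (\<A> (del_edge G e))) (restrict_to e (\<A> (del_edge G e)))) \<le> \<epsilon> \<and>
          d_TV (\<A> (add_edge G e))
            (edge_product e (restrict_away e (\<A> (add_edge G e))) (restrict_to e (\<A> (add_edge G e)))) \<le> \<epsilon> \<and>
          \<bar>measure_pmf.prob (\<A> (del_edge G e)) {H. e \<in> H} - pminus e\<bar> \<le> \<epsilon> \<and>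
          \<bar>measure_pmf.prob (\<A> (add_edge G e)) {H. e \<in> H} - pplus e\<bar> \<le> \<epsilon>)) \<longrightarrow>
      d_TV (bind_pmf (GPS es ps K P0) \<A>)
           (GPS es (\<lambda>i. ps i * pplus (es i) + (1 - ps i) * pminus (es i)) K P0')
        \<le> C * (real K * (\<epsilon> + \<delta>)))"
proof (intro exI[of _ "3::real"] conjI allI impI)
  show "(0::real) < 3"
    by simp
next
  fix n K :: nat and P0 P0' :: "graph pmf" and es :: "nat \<Rightarrow> edge" and ps :: "nat \<Rightarrow> real"
    and \<epsilon> \<delta> :: real and \<G> :: "graph set" and \<A> :: "graph \<Rightarrow> graph pmf"
    and pminus pplus :: "edge \<Rightarrow> real"
  let ?q = "\<lambda>i. ps i * pplus (es i) + (1 - ps i) * pminus (es i)"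
  assume es: "\<forall>i\<in>{1..K}. es i \<in> edges n" and ps: "\<forall>i\<in>{1..K}. ps i \<in> {0..1}"
    and \<epsilon>: "\<epsilon> \<ge> 0" and \<delta>: "\<delta> \<ge> 0"
    and good: "\<forall>i\<le>K. measure_pmf.prob (GPS es ps i P0) \<G> \<ge> 1 - \<delta>"
    and P0': "bind_pmf P0 \<A> = P0'"
    and C: "\<forall>e\<in>edges n. pminus e \<in> {0..1} \<and> pplus e \<in> {0..1} \<and>
        (\<forall>G\<in>\<G>.
          d_TV (restrict_away e (\<A> (del_edge G e))) (restrict_away e (\<A> (add_edge G e))) \<le> \<epsilon> \<and>
          d_TV (\<A> (del_edge G e))
            (edge_product e (restrict_away e (\<A> (del_edge G e))) (restrict_to e (\<A> (del_edge G e)))) \<le> \<epsilon> \<and>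
          d_TV (\<A> (add_edge G e))
            (edge_product e (restrict_away e (\<A> (add_edge G e))) (restrict_to e (\<A> (add_edge G e)))) \<le> \<epsilon> \<and>
          \<bar>measure_pmf.prob (\<A> (del_edge G e)) {H. e \<in> H} - pminus e\<bar> \<le> \<epsilon> \<and>
          \<bar>measure_pmf.prob (\<A> (add_edge G e)) {H. e \<in> H} - pplus e\<bar> \<le> \<epsilon>)"
  \<comment> \<open>\<open>P\<close> is left arbitrary because the step is applied to the law
    reached after each prefix of the resamplings.\<close>
  have step: "d_TV (bind_pmf (resample (es i) (ps i) P) \<A>)
      (resample (es i) (?q i) (bind_pmf P \<A>)) \<le> 3 * \<epsilon> + \<delta>"
    if i: "i \<in> {1..K}" and P: "measure_pmf.prob P \<G> \<ge> 1 - \<delta>" for i P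
  proof -
    \<comment> \<open>Bundling both target probabilities into a function of the edge status turns
      the two halves of (C2), and likewise of (C3), into one statement about all
      \<open>b\<close>.\<close>
    let ?a = "\<lambda>b. if b then pplus (es i) else pminus (es i)"
    have e: "es i \<in> edges n" and p: "ps i \<in> {0..1}"
      using es ps i by auto
    note Ce = C[rule_format, OF e]
    have a: "?a b \<in> {0..1}" for b
      using Ce by simp
    have "d_TV (bind_pmf (resample (es i) (ps i) P) \<A>)
        (resample (es i) (ps i * ?a True + (1 - ps i) * ?a False) (bind_pmf P \<A>)) \<le> 3 * \<epsilon> + \<delta>"
      using Ce by (intro d_TV_resample_step[where \<G> = \<G>] p a \<epsilon> P) (auto simp: set_edge_def)
    then show ?thesis
      by simp
  qed
  have "i \<le> K \<Longrightarrow> d_TV (bind_pmf (GPS es ps i P0) \<A>) (GPS es ?q i P0') \<le> real i * (3 * \<epsilon> + \<delta>)" for i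
  proof (induction i)
    case 0
    then show ?case
      by (simp add: P0')
  next
    case (Suc i)
    let ?P = "GPS es ps i P0" and ?e = "es (Suc i)" and ?p = "ps (Suc i)"
    let ?r = "resample ?e (?q (Suc i))"
    \<comment> \<open>Resampling edge \<open>Suc i\<close> uses the bound on bad graphs at index
      \<open>i\<close>, for the law before that resampling.\<close>
    have "d_TV (bind_pmf (resample ?e ?p ?P) \<A>) (?r (bind_pmf ?P \<A>)) \<le> 3 * \<epsilon> + \<delta>"
      using Suc.prems good by (intro step) auto
    \<comment> \<open>The intermediate law applies \<open>\<A>\<close> before the last resampling.
      From there on both sides undergo the same resampling \<open>?r\<close>, so the induction
      hypothesis carries over without loss.\<close>
    moreover have "d_TV (?r (bind_pmf ?P \<A>)) (?r (GPS es ?q i P0')) \<le> real i * (3 * \<epsilon> + \<delta>)"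
      using d_TV_resample_le Suc.IH[OF Suc_leD[OF Suc.prems]] by (rule order_trans)
    ultimately show ?case
      using d_TV_triangle[of "bind_pmf (resample ?e ?p ?P) \<A>" "?r (GPS es ?q i P0')"
          "?r (bind_pmf ?P \<A>)"]
      by (simp add: algebra_simps)
  qed
  from this[of K] have "d_TV (bind_pmf (GPS es ps K P0) \<A>) (GPS es ?q K P0')
      \<le> real K * (3 * \<epsilon> + \<delta>)"
    by simp
  \<comment> \<open>The absolute constant 3 counts the uses of (C1), (C2) and (C3) per step; the
    single \<delta> is absorbed since it is nonnegative.\<close>
  also have "\<dots> \<le> real K * (3 * (\<epsilon> + \<delta>))"
    using \<delta> by (intro mult_left_mono) auto
  finally show "d_TV (bind_pmf (GPS es ps K P0) \<A>) (GPS es ?q K P0') \<le> 3 * (real K * (\<epsilon> + \<delta>))"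
    by (simp only: mult.left_commute)
qed

end
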